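(* A metric $d$ on a set $X$ is segmentally discrete if and only if the restriction $d|_{F^2}$ is a snowflake for every non-empty finite subset $F \subseteq X$.
   Context: For a metric $d$ on $X$ and $x,y\in X$, the metric segment joining $x,y$ is $[x,y]=\{z\in X : d(x,z)+d(z,y)=d(x,y)\}$. The metric $d$ is segmentally discrete if $[x,y]=\{x,y\}$ holds for all $x,y\in X$. A metric $\rho$ on a set $F$ is a snowflake if there exists a scalar $\alpha\in(0,1)$ such that $\rho^{1/\alpha}$, i.e. the function $(p,q)\mapsto \rho(p,q)^{1/\alpha}$, is also a metric on $F$. (The scalar $\alpha$ is allowed to depend on $F$.) *)

theory Defs
  imports "HOL-Analysis.Abstract_Metric_Spaces"
begin

(* A metric on a set M is the library's Metric_space M d.  There d is total on the type and
   is required to be nonnegative and symmetric also off M; this is no loss of generality,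
   since a metric on M extends by 0.  The restriction of d to F x F is expressed by replacing
   the carrier M by F. *)

definition metric_segment :: "'a set \<Rightarrow> ('a \<Rightarrow> 'a \<Rightarrow> real) \<Rightarrow> 'a \<Rightarrow> 'a \<Rightarrow> 'a set" where
  "metric_segment X d x y = {z \<in> X. d x z + d z y = d x y}"

definition segmentally_discrete :: "'a set \<Rightarrow> ('a \<Rightarrow> 'a \<Rightarrow> real) \<Rightarrow> bool" where
  "segmentally_discrete X d \<longleftrightarrow> (\<forall>x\<in>X. \<forall>y\<in>X. metric_segment X d x y = {x, y})"

(* 0 powr a = 0 and the values of powr are nonnegative, so powr is the usual power of a
   metric, including at the value 0. *)
definition snowflake :: "'a set \<Rightarrow> ('a \<Rightarrow> 'a \<Rightarrow> real) \<Rightarrow> bool" where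
  "snowflake F \<rho> \<longleftrightarrow>
     Metric_space F \<rho> \<and>
     (\<exists>\<alpha>::real. 0 < \<alpha> \<and> \<alpha> < 1 \<and> Metric_space F (\<lambda>p q. \<rho> p q powr (1 / \<alpha>)))"

end

theory Submission imports Defs begin

text \<open>
  Write \<open>s = 1 / \<alpha> > 1\<close> for the exponent of a snowflake. Both directions rest on how the
  inequality \<open>c powr s \<le> a powr s + b powr s\<close> behaves for \<open>s\<close> slightly larger than \<open>1\<close>.

  If \<open>c = a + b\<close> with \<open>a, b > 0\<close>, it fails for every \<open>s > 1\<close>, because \<open>t \<mapsto> t powr s\<close> is strictly
  superadditive (\<open>powr_strictly_superadditive\<close>). Hence a point strictly between two others rules
  out a snowflake already on the three points involved.

  If \<open>c < a + b\<close>, it survives for all \<open>s\<close> close enough to \<open>1\<close>, by continuity in \<open>s\<close>. In a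
  segmentally discrete space every triangle inequality between three distinct points is
  strict, and those with a repeated point hold for all \<open>s\<close>; a finite set has only finitely
  many triples, so one \<open>s > 1\<close> serves them all (\<open>eventually_powr_metric\<close>).
\<close>

text \<open>
  Split off one factor: \<open>(a + b) powr s = a * (a + b) powr (s - 1) + b * (a + b) powr (s - 1)\<close>,
  and \<open>t \<mapsto> t powr (s - 1)\<close> is strictly increasing.
\<close>
lemma powr_strictly_superadditive:
  fixes a b s :: real
  assumes "a > 0" "b > 0" "s > 1"
  shows "a powr s + b powr s < (a + b) powr s"
proof -
  have split_factor: "t powr s = t * t powr (s - 1)" if "t > 0" for t :: real
    using that by (simp add: powr_diff)
  have "a powr (s - 1) < (a + b) powr (s - 1)" "b powr (s - 1) < (a + b) powr (s - 1)"
    using assms by (auto intro!: powr_less_mono2)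
  then have "a * a powr (s - 1) + b * b powr (s - 1)
      < a * (a + b) powr (s - 1) + b * (a + b) powr (s - 1)"
    using assms by (intro add_strict_mono mult_strict_left_mono) auto
  then show ?thesis
    using assms by (simp add: split_factor distrib_right)
qed

lemma eventually_powr_triangle:
  fixes a b c :: real
  assumes "a > 0" "b > 0" "c > 0" "c < a + b"
  shows "\<forall>\<^sub>F s in at_right 1. c powr s \<le> a powr s + b powr s"
proof -
  have lhs: "((\<lambda>s. c powr s) \<longlongrightarrow> c powr 1) (at_right 1)"
    using assms by (intro tendsto_intros) auto
  have rhs: "((\<lambda>s. a powr s + b powr s) \<longlongrightarrow> a powr 1 + b powr 1) (at_right 1)"
    using assms by (intro tendsto_intros) auto
  have "\<forall>\<^sub>F s in at_right 1. 0 < (a powr s + b powr s) - c powr s"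
    using assms by (intro order_tendstoD(1)[OF tendsto_diff[OF rhs lhs]]) simp
  then show ?thesis
    by eventually_elim simp
qed

lemma segmentally_discrete_strict_triangle:
  assumes "Metric_space X d" "segmentally_discrete X d"
    and "x \<in> X" "y \<in> X" "z \<in> X" "y \<noteq> x" "y \<noteq> z"
  shows "d x z < d x y + d y z"
proof -
  have "y \<notin> metric_segment X d x z"
    using assms unfolding segmentally_discrete_def by auto
  moreover have "d x z \<le> d x y + d y z"
    using assms by (simp add: Metric_space.triangle)
  ultimately show ?thesis
    using assms by (auto simp: metric_segment_def)
qed

text \<open>
  Each triple of points imposes a condition on \<open>s\<close> that holds on a right neighbourhood of \<open>1\<close>,
  and for a finite \<open>F\<close> these finitely many neighbourhoods intersect in another one.
\<close>
lemma eventually_powr_metric: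
  assumes M: "Metric_space X d" and discrete: "segmentally_discrete X d"
    and F: "F \<subseteq> X" "finite F"
  shows "\<forall>\<^sub>F s in at_right 1. Metric_space F (\<lambda>p q. d p q powr s)"
proof -
  interpret Metric_space X d by (rule M)
  have "\<forall>\<^sub>F s in at_right 1. d x z powr s \<le> d x y powr s + d y z powr s"
    if "x \<in> F" "y \<in> F" "z \<in> F" for x y z
  proof (cases "x = y \<or> y = z \<or> x = z")
    case True
    with that F have "d x z powr s \<le> d x y powr s + d y z powr s" for s
      by auto
    then show ?thesis by simp
  next
    case False
    then have "d x z < d x y + d y z"
      using that F by (intro segmentally_discrete_strict_triangle[OF M discrete]) auto
    with False that F show ?thesis
      by (intro eventually_powr_triangle mdist_pos_less) auto
  qed
  then have "\<forall>\<^sub>F s in at_right 1. \<forall>x\<in>F. \<forall>y\<in>F. \<forall>z\<in>F.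
      d x z powr s \<le> d x y powr s + d y z powr s"
    using F(2) by (simp add: eventually_ball_finite_distrib)
  then show ?thesis
  proof eventually_elim
    case (elim s)
    then show ?case
      using F(1) by unfold_locales (auto simp: commute subset_iff)
  qed
qed

theorem theorem4p15:
  fixes X :: "'a set" and d :: "'a \<Rightarrow> 'a \<Rightarrow> real"
  assumes "Metric_space X d"
  shows "segmentally_discrete X d \<longleftrightarrow>
    (\<forall>F. F \<subseteq> X \<and> finite F \<and> F \<noteq> {} \<longrightarrow> snowflake F d)"
proof
  assume discrete: "segmentally_discrete X d"
  show "\<forall>F. F \<subseteq> X \<and> finite F \<and> F \<noteq> {} \<longrightarrow> snowflake F d"
  proof (intro allI impI)
    fix F assume F: "F \<subseteq> X \<and> finite F \<and> F \<noteq> {}"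
    have "\<forall>\<^sub>F s in at_right 1. (1::real) < s \<and> Metric_space F (\<lambda>p q. d p q powr s)"
      using F assms discrete
      by (intro eventually_conj eventually_at_right_less eventually_powr_metric) auto
    then obtain s :: real where s: "1 < s" "Metric_space F (\<lambda>p q. d p q powr s)"
      using eventually_happens' trivial_limit_at_right_real by blast
    have "\<exists>\<alpha>::real. 0 < \<alpha> \<and> \<alpha> < 1 \<and> Metric_space F (\<lambda>p q. d p q powr (1 / \<alpha>))"
      using s by (intro exI[of _ "1 / s"]) auto
    then show "snowflake F d"
      using F assms unfolding snowflake_def by (blast intro: Metric_space.subspace)
  qed
next
  assume snow: "\<forall>F. F \<subseteq> X \<and> finite F \<and> F \<noteq> {} \<longrightarrow> snowflake F d"
  interpret Metric_space X d by (rule assms)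
  have "metric_segment X d x y \<subseteq> {x, y}" if "x \<in> X" "y \<in> X" for x y
  proof
    fix z assume "z \<in> metric_segment X d x y"
    then have z: "z \<in> X" "d x y = d x z + d z y"
      by (auto simp: metric_segment_def)
    have "snowflake {x, z, y} d"
      using snow that z by simp
    then obtain \<alpha> :: real where \<alpha>: "0 < \<alpha>" "\<alpha> < 1"
      and power: "Metric_space {x, z, y} (\<lambda>p q. d p q powr (1 / \<alpha>))"
      unfolding snowflake_def by blast
    have "(d x z + d z y) powr (1 / \<alpha>) \<le> d x z powr (1 / \<alpha>) + d z y powr (1 / \<alpha>)"
      using Metric_space.triangle[OF power, of x z y] z by simp
    then have "\<not> (0 < d x z \<and> 0 < d z y)"
      using powr_strictly_superadditive[of "d x z" "d z y" "1 / \<alpha>"] \<alpha> by auto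
    then show "z \<in> {x, y}"
      using that z by auto
  qed
  moreover have "{x, y} \<subseteq> metric_segment X d x y" if "x \<in> X" "y \<in> X" for x y
    using that by (auto simp: metric_segment_def)
  ultimately show "segmentally_discrete X d"
    unfolding segmentally_discrete_def by blast
qed

end
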